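(* Let $q\ge1$ be an integer and $\beta$ a constant. Let $G$ be a finite graph with an interaction energy $J_e$ on each edge $e$ and a magnetic field vector $\boldsymbol{M}_i=(M_{i,1},\dots,M_{i,q})\in\mathbb{C}^q$ at each vertex $v_i$, and let $Z(G)=\sum_{\sigma}\mathrm{e}^{-\beta h(\sigma)}$ with \[h(\sigma)=-\sum_{e=\{v_i,v_j\}\in E(G)}J_{e}\,\delta(\sigma_i,\sigma_j)-\sum_{v_i\in V(G)}\sum_{\alpha=1}^q M_{i,\alpha}\,\delta(\alpha,\sigma_i).\] Then \[Z(G)=\boldsymbol{V}\Big(G,\omega;\{X_{\boldsymbol{M}}\}_{\boldsymbol{M}\in\mathbb{C}^q},\{\mathrm{e}^{\beta J_e}-1\}_{e\in E(G)}\Big),\] where the vertex weights are $\omega(v_i)=\boldsymbol{M}_i$ and, for any $\boldsymbol{M}=(M_1,\dots,M_q)\in\mathbb{C}^q$, $X_{\boldsymbol{M}}=\sum_{\alpha=1}^q\mathrm{e}^{\beta M_\alpha}$.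
   Context: Graphs are finite, loops and multiple edges allowed. A state is a map $\sigma:V(G)\to\{1,\dots,q\}$, $\sigma_i=\sigma(v_i)$; $Z$ sums over all states; $\delta$ is the Kronecker delta. The $\boldsymbol{V}$-polynomial here has vertex weights in the additive semigroup $S=\mathbb{C}^q$, variables $\{x_k\}_{k\in S}$ and edge weights $\gamma_e$, defined recursively by: for a non-loop edge $e$, $\boldsymbol{V}(G)=\boldsymbol{V}(G-e)+\gamma_e\boldsymbol{V}(G/e)$; for a loop $e$, $\boldsymbol{V}(G)=(\gamma_e+1)\boldsymbol{V}(G-e)$; for $m$ isolated vertices of weights $\omega_1,\dots,\omega_m$, $\boldsymbol{V}=\prod x_{\omega_i}$. Here $G-e$ deletes $e$, weights unchanged; $G/e$ contracts a non-loop edge $e=\{v_a,v_b\}$, the merged vertex receiving weight $\omega(v_a)+\omega(v_b)$, all other weights unchanged. The equation means that $x_{\boldsymbol{M}}$ is replaced by $X_{\boldsymbol{M}}$ and $\gamma_e$ by $\mathrm{e}^{\beta J_e}-1$. *)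

theory Defs
  imports "HOL-Analysis.Analysis" "HOL-Library.Poly_Mapping"
begin

text \<open>Multigraphs with loops: each edge name carries its set of endpoints, a singleton exactly
  when the edge is a loop.\<close>

record ('v, 'e) mgraph =
  verts :: "'v set"
  edges :: "'e set"
  ends :: "'e \<Rightarrow> 'v set"

definition finite_mgraph :: "('v, 'e) mgraph \<Rightarrow> bool" where
  "finite_mgraph G \<longleftrightarrow> finite (verts G) \<and> finite (edges G) \<and>
     (\<forall>e\<in>edges G. \<exists>a\<in>verts G. \<exists>b\<in>verts G. ends G e = {a, b})"

definition delete_edge :: "'e \<Rightarrow> ('v, 'e) mgraph \<Rightarrow> ('v, 'e) mgraph" where
  "delete_edge e G = G\<lparr>edges := edges G - {e}\<rparr>"

text \<open>Contraction of a non-loop edge \<open>e\<close> with endpoints \<open>a\<close> and \<open>b\<close>: the merged vertex keeps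
  the name \<open>a\<close>, and every occurrence of \<open>b\<close> as an endpoint is redirected to \<open>a\<close>.\<close>

definition contract_edge :: "'e \<Rightarrow> 'v \<Rightarrow> 'v \<Rightarrow> ('v, 'e) mgraph \<Rightarrow> ('v, 'e) mgraph" where
  "contract_edge e a b G =
     \<lparr>verts = verts G - {b}, edges = edges G - {e},
      ends = (\<lambda>f. (\<lambda>v. if v = b then a else v) ` ends G f)\<rparr>"

definition contract_weight ::
    "'v \<Rightarrow> 'v \<Rightarrow> ('v \<Rightarrow> 'w::ab_semigroup_add) \<Rightarrow> 'v \<Rightarrow> 'w" where
  "contract_weight a b \<omega> = (\<lambda>v. if v = a then \<omega> a + \<omega> b else \<omega> v)"

text \<open>Polynomials with integer coefficients in the commuting indeterminates \<open>x\<^sub>k\<close> (\<open>k\<close> in the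
  weight semigroup) and \<open>\<gamma>\<^sub>e\<close> (\<open>e\<close> an edge name), as finitely supported functions on monomials.\<close>

datatype ('w, 'e) indet = X_indet 'w | Gamma_indet 'e

type_synonym ('w, 'e) vpoly = "(('w, 'e) indet \<Rightarrow>\<^sub>0 nat) \<Rightarrow>\<^sub>0 int"

definition indet_poly :: "('w, 'e) indet \<Rightarrow> ('w, 'e) vpoly" where
  "indet_poly i = Poly_Mapping.single (Poly_Mapping.single i 1) 1"

definition substitute ::
    "('w \<Rightarrow> complex) \<Rightarrow> ('e \<Rightarrow> complex) \<Rightarrow> ('w, 'e) vpoly \<Rightarrow> complex" where
  "substitute x g p =
     (\<Sum>m\<in>Poly_Mapping.keys p. of_int (Poly_Mapping.lookup p m) *
        (\<Prod>i\<in>Poly_Mapping.keys m. case_indet x g i ^ Poly_Mapping.lookup m i))"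

text \<open>\<open>is_V_polynomial G \<omega> p\<close>: the polynomial \<open>p\<close> can be computed from \<open>(G, \<omega>)\<close> by the
  recursion, where every step may use any edge. That the result does not depend on these choices is
  what makes the definite description in \<open>V_polynomial\<close> meaningful.\<close>

inductive is_V_polynomial ::
    "('v, 'e) mgraph \<Rightarrow> ('v \<Rightarrow> 'w::ab_semigroup_add) \<Rightarrow> ('w, 'e) vpoly \<Rightarrow> bool" where
  isolated: "edges G = {} \<Longrightarrow>
     is_V_polynomial G \<omega> (\<Prod>v\<in>verts G. indet_poly (X_indet (\<omega> v)))"
| loop: "\<lbrakk>e \<in> edges G; ends G e = {a}; is_V_polynomial (delete_edge e G) \<omega> p\<rbrakk> \<Longrightarrow>
     is_V_polynomial G \<omega> ((indet_poly (Gamma_indet e) + 1) * p)"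
| non_loop: "\<lbrakk>e \<in> edges G; ends G e = {a, b}; a \<noteq> b;
      is_V_polynomial (delete_edge e G) \<omega> p;
      is_V_polynomial (contract_edge e a b G) (contract_weight a b \<omega>) r\<rbrakk> \<Longrightarrow>
     is_V_polynomial G \<omega> (p + indet_poly (Gamma_indet e) * r)"

definition V_polynomial ::
    "('v, 'e) mgraph \<Rightarrow> ('v \<Rightarrow> 'w::ab_semigroup_add) \<Rightarrow> ('w, 'e) vpoly" where
  "V_polynomial G \<omega> = (THE p. is_V_polynomial G \<omega> p)"

text \<open>The Potts model with \<open>q = CARD('q)\<close> spins, the elements of \<open>'q\<close>.\<close>

definition kronecker :: "'a \<Rightarrow> 'a \<Rightarrow> complex" where
  "kronecker i j = (if i = j then 1 else 0)"

definition edge_delta :: "('v, 'e) mgraph \<Rightarrow> ('v \<Rightarrow> 'q) \<Rightarrow> 'e \<Rightarrow> complex" where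
  "edge_delta G \<sigma> e = (if \<forall>u\<in>ends G e. \<forall>v\<in>ends G e. \<sigma> u = \<sigma> v then 1 else 0)"

lemma edge_delta_eq: "ends G e = {a, b} \<Longrightarrow> edge_delta G \<sigma> e = kronecker (\<sigma> a) (\<sigma> b)"
  by (auto simp: edge_delta_def kronecker_def)

definition hamiltonian ::
    "('v, 'e) mgraph \<Rightarrow> ('e \<Rightarrow> complex) \<Rightarrow> ('v \<Rightarrow> complex ^ 'q) \<Rightarrow> ('v \<Rightarrow> 'q::finite) \<Rightarrow> complex" where
  "hamiltonian G J M \<sigma> =
     - (\<Sum>e\<in>edges G. J e * edge_delta G \<sigma> e)
     - (\<Sum>v\<in>verts G. \<Sum>\<alpha>\<in>UNIV. M v $ \<alpha> * kronecker \<alpha> (\<sigma> v))"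

definition states :: "('v, 'e) mgraph \<Rightarrow> ('v \<Rightarrow> 'q) set" where
  "states G = verts G \<rightarrow>\<^sub>E UNIV"

definition partition_function ::
    "complex \<Rightarrow> ('v, 'e) mgraph \<Rightarrow> ('e \<Rightarrow> complex) \<Rightarrow> ('v \<Rightarrow> complex ^ 'q::finite) \<Rightarrow> complex" where
  "partition_function \<beta> G J M = (\<Sum>\<sigma>\<in>states G. exp (- \<beta> * hamiltonian G J M \<sigma>))"

definition X_field :: "complex \<Rightarrow> complex ^ 'q::finite \<Rightarrow> complex" where
  "X_field \<beta> M = (\<Sum>\<alpha>\<in>UNIV. exp (\<beta> * M $ \<alpha>))"

end

theory Submission imports Defs begin

text \<open>Any polynomial produced by the recursion equals the subset expansion
  \<open>\<Sum>\<^bsub>A \<subseteq> E\<^esub> \<Prod>\<^bsub>e \<in> A\<^esub> \<gamma>\<^sub>e \<Prod>\<^bsub>C\<^esub> x\<^bsub>\<omega>(C)\<^esub>\<close>, where \<open>C\<close> runs through the components of the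
  spanning subgraph \<open>(V, A)\<close> and \<open>\<omega>(C)\<close> is the total weight of \<open>C\<close>: the subsets avoiding \<open>e\<close>
  give \<open>G - e\<close>, those containing \<open>e\<close> give \<open>G / e\<close>. Hence the recursion is independent of the
  choice of edges. The partition function obeys the same recursion because
  \<open>exp (\<beta> J \<delta>) = 1 + (exp (\<beta> J) - 1) \<delta>\<close> for \<open>\<delta> \<in> {0, 1}\<close>, and the states with equal spins at
  the ends of \<open>e\<close> are the states of \<open>G / e\<close>.\<close>

section \<open>Evaluation of polynomials\<close>

definition monomial_value :: "('a \<Rightarrow> complex) \<Rightarrow> ('a \<Rightarrow>\<^sub>0 nat) \<Rightarrow> complex" where
  "monomial_value v m = (\<Prod>i\<in>Poly_Mapping.keys m. v i ^ Poly_Mapping.lookup m i)"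

lemma monomial_value_superset:
  assumes "finite I" "Poly_Mapping.keys m \<subseteq> I"
  shows "monomial_value v m = (\<Prod>i\<in>I. v i ^ Poly_Mapping.lookup m i)"
  unfolding monomial_value_def
  by (rule prod.mono_neutral_left) (use assms in \<open>auto simp: in_keys_iff\<close>)

lemma monomial_value_zero [simp]: "monomial_value v 0 = 1"
  by (simp add: monomial_value_def)

lemma monomial_value_add:
  "monomial_value v (m + n) = monomial_value v m * monomial_value v n"
proof -
  \<comment> \<open>The three products are compared over one common index set; indices outside the
    support of a monomial contribute zeroth powers, that is 1.\<close>
  let ?I = "Poly_Mapping.keys m \<union> Poly_Mapping.keys n"
  have "monomial_value v k = (\<Prod>i\<in>?I. v i ^ Poly_Mapping.lookup k i)" if "k \<in> {m, n, m + n}" for k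
    by (rule monomial_value_superset) (use that keys_add[of m n] in auto)
  then show ?thesis
    by (simp add: lookup_add power_add prod.distrib)
qed

lemma substitute_eq:
  "substitute x g p = (\<Sum>m\<in>Poly_Mapping.keys p.
     of_int (Poly_Mapping.lookup p m) * monomial_value (case_indet x g) m)"
  by (simp add: substitute_def monomial_value_def)

lemma substitute_add: "substitute x g (p + r) = substitute x g p + substitute x g r"
  unfolding substitute_eq by (rule setsum_keys_plus_distrib) (simp_all add: distrib_right)

lemma substitute_single:
  "substitute x g (Poly_Mapping.single m c) = of_int c * monomial_value (case_indet x g) m"
  by (simp add: substitute_eq)

lemma substitute_zero [simp]: "substitute x g 0 = 0"
  by (simp add: substitute_eq)

lemma substitute_one [simp]: "substitute x g 1 = 1"
  by (simp add: substitute_eq)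

lemma substitute_indet_poly [simp]: "substitute x g (indet_poly i) = case_indet x g i"
  by (simp add: indet_poly_def substitute_single monomial_value_def)

text \<open>Rewrites the step of \<open>update_induct\<close> as the addition of a fresh monomial,
  so that additivity of \<open>substitute\<close> applies.\<close>

lemma update_eq_single_add:
  fixes f :: "'a \<Rightarrow>\<^sub>0 'b::monoid_add"
  assumes "a \<notin> Poly_Mapping.keys f"
  shows "Poly_Mapping.update a b f = Poly_Mapping.single a b + f"
  using assms
  by (intro poly_mapping_eqI) (auto simp: lookup_update lookup_add lookup_single in_keys_iff when_def)

text \<open>Both sides are additive in each factor, so induction on \<open>p\<close>, and on
  \<open>r\<close> with a single monomial on the left, leaves only products of two monomials,
  settled by \<open>monomial_value_add\<close>.\<close>

lemma substitute_mult: "substitute x g (p * r) = substitute x g p * substitute x g r"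
proof (induction p rule: update_induct)
  case const
  then show ?case by simp
next
  case (update p m c)
  have "substitute x g (Poly_Mapping.single m c * r)
      = substitute x g (Poly_Mapping.single m c) * substitute x g r"
  proof (induction r rule: update_induct)
    case const
    then show ?case by simp
  next
    case (update r n d)
    then show ?case
      by (simp add: update_eq_single_add distrib_left substitute_add mult_single
          substitute_single monomial_value_add)
  qed
  with update show ?case
    by (simp add: update_eq_single_add distrib_right substitute_add)
qed

lemma substitute_prod: "substitute x g (\<Prod>i\<in>I. f i) = (\<Prod>i\<in>I. substitute x g (f i))"
  by (induction I rule: infinite_finite_induct) (simp_all add: substitute_mult)

section \<open>Deletion and contraction\<close>

definition merge :: "'v \<Rightarrow> 'v \<Rightarrow> 'v \<Rightarrow> 'v" where
  "merge a b v = (if v = b then a else v)"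

lemma merge_simps [simp]: "merge a b b = a" "merge a b a = a" "v \<noteq> b \<Longrightarrow> merge a b v = v"
  by (simp_all add: merge_def)

lemma merge_image_verts:
  assumes "a \<in> V" "a \<noteq> b"
  shows "merge a b ` V = V - {b}"
  using assms by (force simp: merge_def)

lemma delete_edge_simps [simp]:
  "verts (delete_edge e G) = verts G" "edges (delete_edge e G) = edges G - {e}"
  "ends (delete_edge e G) = ends G"
  by (simp_all add: delete_edge_def)

lemma contract_edge_simps [simp]:
  "verts (contract_edge e a b G) = verts G - {b}" "edges (contract_edge e a b G) = edges G - {e}"
  "ends (contract_edge e a b G) f = merge a b ` ends G f"
  by (simp_all add: contract_edge_def merge_def[abs_def])

lemma finite_mgraph_ends:
  assumes "finite_mgraph G" "f \<in> edges G"
  shows "ends G f \<subseteq> verts G"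
  using assms by (fastforce simp: finite_mgraph_def)

lemma finite_mgraph_delete: "finite_mgraph G \<Longrightarrow> finite_mgraph (delete_edge e G)"
  by (auto simp: finite_mgraph_def)

lemma finite_mgraph_contract:
  assumes G: "finite_mgraph G" and "e \<in> edges G" "ends G e = {a, b}" "a \<noteq> b"
  shows "finite_mgraph (contract_edge e a b G)"
proof -
  have a: "a \<in> verts G"
    using finite_mgraph_ends[OF G \<open>e \<in> edges G\<close>] assms(3) by auto
  have "\<exists>c\<in>verts G - {b}. \<exists>d\<in>verts G - {b}. merge a b ` ends G f = {c, d}" if f: "f \<in> edges G" for f
  proof -
    obtain c d where "c \<in> verts G" "d \<in> verts G" "ends G f = {c, d}"
      using G f by (auto simp: finite_mgraph_def)
    then have "merge a b ` ends G f = {merge a b c, merge a b d}"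
      "merge a b c \<in> verts G - {b}" "merge a b d \<in> verts G - {b}"
      using merge_image_verts[OF a \<open>a \<noteq> b\<close>] by auto
    then show ?thesis by blast
  qed
  with G show ?thesis
    unfolding finite_mgraph_def by auto
qed

section \<open>The subset expansion\<close>

text \<open>The full square of each endpoint set makes the relation symmetric, so its reflexive
  transitive closure is already an equivalence.\<close>

definition adj :: "('v, 'e) mgraph \<Rightarrow> 'e set \<Rightarrow> ('v \<times> 'v) set" where
  "adj G A = (\<Union>f\<in>A. ends G f \<times> ends G f)"

definition component :: "('v, 'e) mgraph \<Rightarrow> 'e set \<Rightarrow> 'v \<Rightarrow> 'v set" where
  "component G A v = {u \<in> verts G. (v, u) \<in> (adj G A)\<^sup>*}"

definition components :: "('v, 'e) mgraph \<Rightarrow> 'e set \<Rightarrow> 'v set set" where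
  "components G A = component G A ` verts G"

definition subset_term ::
    "('v, 'e) mgraph \<Rightarrow> ('v \<Rightarrow> 'w::comm_monoid_add) \<Rightarrow> 'e set \<Rightarrow> ('w, 'e) vpoly" where
  "subset_term G \<omega> A = (\<Prod>f\<in>A. indet_poly (Gamma_indet f)) *
     (\<Prod>C\<in>components G A. indet_poly (X_indet (sum \<omega> C)))"

definition subset_expansion ::
    "('v, 'e) mgraph \<Rightarrow> ('v \<Rightarrow> 'w::comm_monoid_add) \<Rightarrow> ('w, 'e) vpoly" where
  "subset_expansion G \<omega> = (\<Sum>A\<in>Pow (edges G). subset_term G \<omega> A)"

text \<open>\<open>adj\<close> takes its edges from \<open>A\<close> and not from the field
  \<open>edges\<close>, and deletion changes only that field.\<close>

lemma subset_term_delete [simp]: "subset_term (delete_edge e G) \<omega> A = subset_term G \<omega> A"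
  by (simp add: subset_term_def components_def component_def[abs_def] adj_def)

lemma subset_expansion_split:
  assumes "finite_mgraph G" "e \<in> edges G"
  shows "subset_expansion G \<omega> = subset_expansion (delete_edge e G) \<omega> +
    (\<Sum>A\<in>Pow (edges G - {e}). subset_term G \<omega> (insert e A))"
proof -
  have fin: "finite (edges G)" using assms by (simp add: finite_mgraph_def)
  have "Pow (edges G) = Pow (edges G - {e}) \<union> insert e ` Pow (edges G - {e})"
    using assms(2) Pow_insert[of e "edges G - {e}"] by (simp add: insert_absorb)
  moreover have "inj_on (insert e) (Pow (edges G - {e}))"
    by (auto simp: inj_on_def)
  ultimately show ?thesis
    using fin unfolding subset_expansion_def
    by (subst \<open>Pow (edges G) = _\<close>, subst sum.union_disjoint)
       (auto simp: sum.reindex)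
qed

lemma subset_expansion_isolated:
  assumes "edges G = {}"
  shows "subset_expansion G \<omega> = (\<Prod>v\<in>verts G. indet_poly (X_indet (\<omega> v)))"
proof -
  have "component G {} v = {v}" if "v \<in> verts G" for v
    using that by (auto simp: component_def adj_def)
  then have "components G {} = (\<lambda>v. {v}) ` verts G"
    by (auto simp: components_def)
  then show ?thesis
    by (simp add: subset_expansion_def assms subset_term_def prod.reindex)
qed

text \<open>A loop adds only the pair \<open>(a, a)\<close>, which the reflexive closure already
  contains.\<close>

lemma components_insert_loop:
  assumes "ends G e = {a}"
  shows "components G (insert e A) = components G A"
proof -
  have "(adj G (insert e A))\<^sup>* = (adj G A)\<^sup>*"
    by (rule rtrancl_subset) (use assms in \<open>auto simp: adj_def\<close>)
  then show ?thesis
    by (simp add: components_def component_def[abs_def])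
qed

lemma subset_expansion_loop:
  assumes G: "finite_mgraph G" and e: "e \<in> edges G" "ends G e = {a}"
  shows "subset_expansion G \<omega> =
    (indet_poly (Gamma_indet e) + 1) * subset_expansion (delete_edge e G) \<omega>"
proof -
  have "subset_term G \<omega> (insert e A) = indet_poly (Gamma_indet e) * subset_term G \<omega> A"
    if "A \<in> Pow (edges G - {e})" for A
  proof -
    have "finite A" "e \<notin> A"
      using that G finite_subset[of A "edges G"] by (auto simp: finite_mgraph_def)
    then show ?thesis
      by (simp add: subset_term_def components_insert_loop[OF e(2)] mult.assoc)
  qed
  then show ?thesis
    by (subst subset_expansion_split[OF G e(1)])
       (simp add: subset_expansion_def distrib_right sum_distrib_left sum.distrib add.commute)
qed

text \<open>A walk projects along \<open>merge a b\<close>, a step along \<open>e\<close> becoming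
  stationary. Conversely, \<open>e\<close> links every vertex to its image, so each step of the
  contracted graph lifts to a walk that may use \<open>e\<close>.\<close>

lemma connected_contract_iff:
  assumes e: "ends G e = {a, b}"
  shows "(u, v) \<in> (adj G (insert e A))\<^sup>* \<longleftrightarrow>
    (merge a b u, merge a b v) \<in> (adj (contract_edge e a b G) A)\<^sup>*"
proof
  assume "(u, v) \<in> (adj G (insert e A))\<^sup>*"
  then show "(merge a b u, merge a b v) \<in> (adj (contract_edge e a b G) A)\<^sup>*"
  proof induction
    case base
    show ?case by simp
  next
    case (step y z)
    then consider "y \<in> {a, b}" "z \<in> {a, b}" | f where "f \<in> A" "y \<in> ends G f" "z \<in> ends G f"
      by (auto simp: adj_def e)
    then show ?case
    proof cases
      case 1
      then have "merge a b y = merge a b z" by auto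
      with step.IH show ?thesis by simp
    next
      case 2
      then have "(merge a b y, merge a b z) \<in> adj (contract_edge e a b G) A"
        by (auto simp: adj_def)
      with step.IH show ?thesis by (rule rtrancl_into_rtrancl)
    qed
  qed
next
  let ?R = "(adj G (insert e A))\<^sup>*"
  have ab: "(a, b) \<in> ?R" "(b, a) \<in> ?R" by (auto simp: adj_def e)
  then have mg: "(w, merge a b w) \<in> ?R" "(merge a b w, w) \<in> ?R" for w
    by (auto simp: merge_def)
  have "adj (contract_edge e a b G) A \<subseteq> ?R"
  proof (clarify)
    fix y z assume "(y, z) \<in> adj (contract_edge e a b G) A"
    then obtain f y' z' where f: "f \<in> A" "y' \<in> ends G f" "z' \<in> ends G f"
      and yz: "y = merge a b y'" "z = merge a b z'"
      by (auto simp: adj_def)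
    from f have "(y', z') \<in> ?R" by (auto simp: adj_def)
    with mg yz show "(y, z) \<in> ?R" by (blast intro: rtrancl_trans)
  qed
  then have sub: "(adj (contract_edge e a b G) A)\<^sup>* \<subseteq> ?R"
    by (rule rtrancl_subset_rtrancl)
  assume "(merge a b u, merge a b v) \<in> (adj (contract_edge e a b G) A)\<^sup>*"
  with sub have "(merge a b u, merge a b v) \<in> ?R" by blast
  with mg show "(u, v) \<in> ?R" by (blast intro: rtrancl_trans)
qed

lemma component_contract:
  assumes e: "ends G e = {a, b}" and ab: "a \<in> verts G" "a \<noteq> b"
  shows "component (contract_edge e a b G) A (merge a b v)
    = merge a b ` component G (insert e A) v"
proof -
  have "w \<in> component (contract_edge e a b G) A (merge a b v)
      \<longleftrightarrow> w \<in> merge a b ` component G (insert e A) v" (is "?l \<longleftrightarrow> ?r") for w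
  proof
    assume ?l
    then show ?r
      \<comment> \<open>A vertex of the contraction differs from \<open>b\<close>, so it is its own
        preimage under \<open>merge a b\<close>.\<close>
      by (intro image_eqI[of _ _ w]) (auto simp: component_def connected_contract_iff[OF e])
  next
    assume ?r
    then show ?l
      using merge_image_verts[OF ab] by (auto simp: component_def connected_contract_iff[OF e])
  qed
  then show ?thesis by blast
qed

text \<open>Taking images under \<open>merge a b\<close> is a weight-preserving bijection between
  the components of the two spanning subgraphs; the factor for \<open>e\<close> comes from
  \<open>e \<notin> A\<close>.\<close>

lemma subset_term_contract:
  assumes G: "finite_mgraph G" and e: "e \<in> edges G" "ends G e = {a, b}" "a \<noteq> b"
    and A: "A \<subseteq> edges G - {e}"
  shows "subset_term G \<omega> (insert e A) = indet_poly (Gamma_indet e) *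
    subset_term (contract_edge e a b G) (contract_weight a b \<omega>) A"
proof -
  let ?H = "contract_edge e a b G"
  let ?m = "merge a b"
  let ?K = "components G (insert e A)"
  have ab: "a \<in> verts G" "b \<in> verts G"
    using finite_mgraph_ends[OF G e(1)] e(2) by auto
  have fin: "finite A" "e \<notin> A" "finite (verts G)"
    using A G finite_subset[of A "edges G"] by (auto simp: finite_mgraph_def)
  \<comment> \<open>The edge \<open>e\<close> is present, so no component separates \<open>a\<close>
    from \<open>b\<close>.\<close>
  have a_iff_b: "a \<in> C \<longleftrightarrow> b \<in> C" and C_sub: "C \<subseteq> verts G" if "C \<in> ?K" for C
    using that ab e(3) by (auto simp: components_def component_def connected_contract_iff[OF e(2)])
  have inj: "inj_on ((`) ?m) ?K"
  proof (rule inj_onI)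
    fix C D assume CD: "C \<in> ?K" "D \<in> ?K" "?m ` C = ?m ` D"
    \<comment> \<open>By \<open>a_iff_b\<close>, \<open>C\<close> is a union of fibres of
      \<open>merge a b\<close>, hence recoverable from its image.\<close>
    have "C = {v. ?m v \<in> ?m ` C}" if "C \<in> ?K" for C
      using a_iff_b[OF that] e(3) by (auto simp: merge_def split: if_splits)
    from this[OF CD(1)] this[OF CD(2)] CD(3) show "C = D" by simp
  qed
  have "verts ?H = ?m ` verts G"
    using merge_image_verts[OF ab(1) e(3)] by simp
  then have comps: "components ?H A = (`) ?m ` ?K"
    by (simp only: components_def image_image component_contract[OF e(2) ab(1) e(3)])
  \<comment> \<open>If \<open>C\<close> contains \<open>a\<close> and \<open>b\<close>, its image
    loses \<open>b\<close>, but the new weight at \<open>a\<close> is the sum of both; otherwise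
    \<open>C\<close> contains neither and nothing changes.\<close>
  have weight: "sum (contract_weight a b \<omega>) (?m ` C) = sum \<omega> C" if C: "C \<in> ?K" for C
  proof (cases "b \<in> C")
    case True
    have f: "finite C" using C_sub[OF C] fin(3) finite_subset by blast
    have *: "a \<in> C" "?m ` C = insert a (C - {a, b})"
      using True a_iff_b[OF C] e(3) by (auto simp: merge_def)
    have "sum \<omega> C = \<omega> a + (\<omega> b + sum \<omega> (C - {a} - {b}))"
      using True * f e(3) by (subst sum.remove[of C a], simp, simp, subst sum.remove[of _ b]) auto
    also have "C - {a} - {b} = C - {a, b}" by auto
    finally show ?thesis
      using * f by (simp add: contract_weight_def add.assoc)
  next
    case False
    then have "?m ` C = C" "a \<notin> C"
      using a_iff_b[OF C] by (auto simp: merge_def)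
    then show ?thesis
      by (auto simp: contract_weight_def intro!: sum.cong)
  qed
  show ?thesis
    using fin by (simp add: subset_term_def comps prod.reindex[OF inj] weight mult.assoc)
qed

lemma subset_expansion_non_loop:
  assumes G: "finite_mgraph G" and e: "e \<in> edges G" "ends G e = {a, b}" "a \<noteq> b"
  shows "subset_expansion G \<omega> = subset_expansion (delete_edge e G) \<omega> +
    indet_poly (Gamma_indet e) *
      subset_expansion (contract_edge e a b G) (contract_weight a b \<omega>)"
  by (subst subset_expansion_split[OF G e(1)])
     (simp add: subset_expansion_def[of "contract_edge e a b G"] sum_distrib_left
       subset_term_contract[OF assms])

section \<open>Uniqueness and existence of the polynomial given by the recursion\<close>

lemma is_V_polynomial_eq_subset_expansion:
  fixes \<omega> :: "'v \<Rightarrow> 'w::comm_monoid_add"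
  assumes "is_V_polynomial G \<omega> p" "finite_mgraph G"
  shows "p = subset_expansion G \<omega>"
  using assms
proof induction
  case (isolated G \<omega>)
  then show ?case by (simp add: subset_expansion_isolated)
next
  case (loop e G a \<omega> p)
  then show ?case by (simp add: subset_expansion_loop[of G e a] finite_mgraph_delete)
next
  case (non_loop e G a b \<omega> p r)
  then show ?case
    by (simp add: subset_expansion_non_loop[of G e a b] finite_mgraph_delete finite_mgraph_contract)
qed

text \<open>Deletion and contraction both lower the number of edges; the induction generalizes over
  \<open>G\<close> and \<open>\<omega>\<close> because contraction changes the weights too.\<close>

lemma is_V_polynomial_exists:
  assumes "finite_mgraph G"
  shows "\<exists>p. is_V_polynomial G \<omega> p"
  using assms
proof (induction "card (edges G)" arbitrary: G \<omega> rule: less_induct)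
  case less
  have fin: "finite (edges G)" using less.prems by (simp add: finite_mgraph_def)
  show ?case
  proof (cases "edges G = {}")
    case True
    then show ?thesis using isolated by blast
  next
    case False
    then obtain e where e: "e \<in> edges G" by blast
    obtain a b where ab: "ends G e = {a, b}"
      using less.prems e by (auto simp: finite_mgraph_def)
    have card: "card (edges G - {e}) < card (edges G)"
      using fin e by (rule card_Diff1_less)
    obtain p where p: "is_V_polynomial (delete_edge e G) \<omega> p"
      using less.hyps[OF _ finite_mgraph_delete[OF less.prems], of e \<omega>] card by auto
    show ?thesis
    proof (cases "a = b")
      case True
      with ab e p show ?thesis by (auto intro: loop)
    next
      case False
      obtain r where "is_V_polynomial (contract_edge e a b G) (contract_weight a b \<omega>) r"
        using less.hyps[OF _ finite_mgraph_contract[OF less.prems e ab False],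
            of "contract_weight a b \<omega>"] card by auto
      with ab e p False show ?thesis by (blast intro: non_loop)
    qed
  qed
qed

lemma is_V_polynomial_V_polynomial:
  fixes \<omega> :: "'v \<Rightarrow> 'w::comm_monoid_add"
  assumes "finite_mgraph G"
  shows "is_V_polynomial G \<omega> (V_polynomial G \<omega>)"
  unfolding V_polynomial_def
proof (rule theI')
  show "\<exists>!p. is_V_polynomial G \<omega> p"
    using is_V_polynomial_exists[OF assms] is_V_polynomial_eq_subset_expansion[OF _ assms] by metis
qed

section \<open>The partition function\<close>

lemma hamiltonian_eq:
  "hamiltonian G J M \<sigma> =
     - (\<Sum>e\<in>edges G. J e * edge_delta G \<sigma> e) - (\<Sum>v\<in>verts G. M v $ \<sigma> v)"
proof -
  have "(\<Sum>\<alpha>\<in>UNIV. M v $ \<alpha> * kronecker \<alpha> (\<sigma> v)) = M v $ \<sigma> v" for v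
    by (simp add: kronecker_def if_distrib[where f = "(*) _"] cong: if_cong)
  then show ?thesis by (simp add: hamiltonian_def)
qed

lemma states_delete [simp]: "states (delete_edge e G) = states G"
  by (simp add: states_def)

lemma hamiltonian_delete:
  assumes "finite_mgraph G" "e \<in> edges G"
  shows "hamiltonian G J M \<sigma> = hamiltonian (delete_edge e G) J M \<sigma> - J e * edge_delta G \<sigma> e"
proof -
  have "finite (edges G)" using assms by (simp add: finite_mgraph_def)
  then show ?thesis
    using assms(2) by (simp add: hamiltonian_eq edge_delta_def sum.remove[of "edges G" e])
qed

text \<open>Without edges the Boltzmann factor is a product over vertices, and
  \<open>prod_sum_PiE\<close> turns a product of sums over spins into a sum over states.\<close>

lemma partition_function_isolated:
  assumes "finite_mgraph G" "edges G = {}"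
  shows "partition_function \<beta> G J M = (\<Prod>v\<in>verts G. X_field \<beta> (M v))"
  using assms
  by (simp add: partition_function_def hamiltonian_eq X_field_def states_def finite_mgraph_def
      prod_sum_PiE sum_distrib_left sum_negf flip: exp_sum)

lemma partition_function_loop:
  assumes "finite_mgraph G" "e \<in> edges G" "ends G e = {a}"
  shows "partition_function \<beta> G J M = exp (\<beta> * J e) * partition_function \<beta> (delete_edge e G) J M"
proof -
  have "edge_delta G \<sigma> e = 1" for \<sigma> :: "'a \<Rightarrow> 'c"
    using assms(3) by (simp add: edge_delta_def)
  then show ?thesis
    by (simp add: partition_function_def hamiltonian_delete[OF assms(1,2)] sum_distrib_left
        right_diff_distrib exp_diff exp_minus field_simps)
qed

text \<open>The fields at \<open>a\<close> and \<open>b\<close> are read at the same spin, so they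
  add up to the field of the merged vertex. Restriction makes \<open>\<sigma>\<close> undefined at
  the removed vertex \<open>b\<close>, as the extensional states of the contraction demand.\<close>

lemma hamiltonian_contract:
  assumes G: "finite_mgraph G" and e: "e \<in> edges G" "ends G e = {a, b}" "a \<noteq> b"
    and \<sigma>: "\<sigma> a = \<sigma> b"
  shows "hamiltonian (contract_edge e a b G) J (contract_weight a b M) (restrict \<sigma> (verts G - {b}))
    = hamiltonian (delete_edge e G) J M \<sigma>"
proof -
  let ?\<tau> = "restrict \<sigma> (verts G - {b})"
  have ab: "a \<in> verts G" "b \<in> verts G"
    using finite_mgraph_ends[OF G e(1)] e(2) by auto
  \<comment> \<open>Redirecting an endpoint from \<open>b\<close> to \<open>a\<close> does not
    change the spin read there, so all remaining edge deltas agree.\<close>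
  have "?\<tau> (merge a b v) = \<sigma> v" if "v \<in> verts G" for v
    using that ab e(3) \<sigma> by (auto simp: merge_def)
  then have "edge_delta (contract_edge e a b G) ?\<tau> f = edge_delta (delete_edge e G) \<sigma> f"
    if "f \<in> edges G" for f
    using finite_mgraph_ends[OF G that] by (simp add: edge_delta_def subset_iff)
  then have edges: "(\<Sum>f\<in>edges G - {e}. J f * edge_delta (contract_edge e a b G) ?\<tau> f)
      = (\<Sum>f\<in>edges G - {e}. J f * edge_delta (delete_edge e G) \<sigma> f)"
    by simp
  have fin: "finite (verts G)" using G by (simp add: finite_mgraph_def)
  have "(\<Sum>v\<in>verts G - {b}. contract_weight a b M v $ ?\<tau> v)
      = (\<Sum>v\<in>verts G - {b}. contract_weight a b M v $ \<sigma> v)"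
    by simp
  also have "\<dots> = (M a + M b) $ \<sigma> a + (\<Sum>v\<in>verts G - {b} - {a}. M v $ \<sigma> v)"
    using fin ab e(3) by (subst sum.remove[of _ a]) (auto simp: contract_weight_def)
  also have "\<dots> = (\<Sum>v\<in>verts G. M v $ \<sigma> v)"
    using fin ab e(3) \<sigma>
    by (simp add: sum.remove[of "verts G" b] sum.remove[of "verts G - {b}" a])
  finally show ?thesis
    using edges by (simp add: hamiltonian_eq)
qed

lemma partition_function_non_loop:
  fixes M :: "'v \<Rightarrow> complex ^ 'q::finite"
  assumes G: "finite_mgraph G" and e: "e \<in> edges G" "ends G e = {a, b}" "a \<noteq> b"
  shows "partition_function \<beta> G J M = partition_function \<beta> (delete_edge e G) J M +
    (exp (\<beta> * J e) - 1) *
      partition_function \<beta> (contract_edge e a b G) J (contract_weight a b M)"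
proof -
  let ?B = "\<lambda>\<sigma>. exp (- \<beta> * hamiltonian (delete_edge e G) J M \<sigma>)"
  let ?S = "{\<sigma> \<in> states G. \<sigma> a = \<sigma> b}"
  have ab: "a \<in> verts G" "b \<in> verts G"
    using finite_mgraph_ends[OF G e(1)] e(2) by auto
  have fin: "finite (states G :: ('v \<Rightarrow> 'q) set)"
    using G by (simp add: states_def finite_mgraph_def finite_PiE)
  have "exp (- \<beta> * hamiltonian G J M \<sigma>) =
      ?B \<sigma> + (exp (\<beta> * J e) - 1) * (if \<sigma> a = \<sigma> b then ?B \<sigma> else 0)" for \<sigma>
    unfolding hamiltonian_delete[OF G e(1)] edge_delta_eq[of G, OF e(2)] kronecker_def
    by (simp add: right_diff_distrib exp_diff exp_minus field_simps)
  then have "partition_function \<beta> G J M =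
      partition_function \<beta> (delete_edge e G) J M + (exp (\<beta> * J e) - 1) * (\<Sum>\<sigma>\<in>?S. ?B \<sigma>)"
    unfolding partition_function_def sum.inter_filter[OF fin]
    by (simp only: sum.distrib sum_distrib_left states_delete)
  also have "(\<Sum>\<sigma>\<in>?S. ?B \<sigma>) =
      partition_function \<beta> (contract_edge e a b G) J (contract_weight a b M)"
    unfolding partition_function_def
  \<comment> \<open>Forgetting the spin at \<open>b\<close> is inverted by copying the spin of
    \<open>a\<close> to \<open>b\<close>, exactly because the two spins agree on
    \<open>?S\<close>.\<close>
  proof (rule sum.reindex_bij_witness[where i = "\<lambda>\<tau>. \<tau>(b := \<tau> a)"
        and j = "\<lambda>\<sigma>. restrict \<sigma> (verts G - {b})"])
    fix \<sigma> :: "'v \<Rightarrow> 'q" assume \<sigma>: "\<sigma> \<in> ?S"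
    show "(restrict \<sigma> (verts G - {b}))(b := restrict \<sigma> (verts G - {b}) a) = \<sigma>"
      \<comment> \<open>Outside \<open>verts G\<close> both functions are \<open>undefined\<close>,
        which gives equality at every argument.\<close>
      using \<sigma> ab e(3) PiE_arb[of \<sigma> "verts G" "\<lambda>_. UNIV"]
      by (intro ext) (simp add: states_def restrict_def)
    show "restrict \<sigma> (verts G - {b}) \<in> states (contract_edge e a b G)"
      by (auto simp: states_def)
    show "exp (- \<beta> * hamiltonian (contract_edge e a b G) J (contract_weight a b M)
        (restrict \<sigma> (verts G - {b}))) = ?B \<sigma>"
      using \<sigma> by (simp add: hamiltonian_contract[OF assms])
  next
    fix \<tau> :: "'v \<Rightarrow> 'q" assume \<tau>: "\<tau> \<in> states (contract_edge e a b G)"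
    show "restrict (\<tau>(b := \<tau> a)) (verts G - {b}) = \<tau>"
      using \<tau> PiE_arb[of \<tau> "verts G - {b}" "\<lambda>_. UNIV"]
      by (intro ext) (simp add: states_def restrict_def)
    show "\<tau>(b := \<tau> a) \<in> ?S"
      using \<tau> ab e(3) by (auto simp: states_def PiE_iff extensional_def)
  qed
  finally show ?thesis .
qed

text \<open>Induction on the derivation follows whichever edges the recursion chose. At a loop,
  \<open>\<gamma> + 1\<close> evaluates to \<open>exp (\<beta> * J e)\<close>; \<open>J\<close>
  stays fixed throughout because surviving edges keep their names.\<close>

lemma partition_function_eq_substitute:
  fixes M :: "'v \<Rightarrow> complex ^ 'q::finite"
  assumes "is_V_polynomial G M p" "finite_mgraph G"
  shows "partition_function \<beta> G J M = substitute (X_field \<beta>) (\<lambda>e. exp (\<beta> * J e) - 1) p"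
  using assms
proof induction
  case (isolated G M)
  then show ?case by (simp add: partition_function_isolated substitute_prod)
next
  case (loop e G a M p)
  then show ?case
    by (simp add: partition_function_loop[of G e a] finite_mgraph_delete substitute_mult substitute_add)
next
  case (non_loop e G a b M p r)
  then show ?case
    by (simp add: partition_function_non_loop[of G e a b] finite_mgraph_delete finite_mgraph_contract
        substitute_mult substitute_add)
qed

theorem theorem4p2:
  fixes G :: "('v, 'e) mgraph"
    and \<beta> :: complex
    and J :: "'e \<Rightarrow> complex"
    and M :: "'v \<Rightarrow> complex ^ 'q::finite"
  assumes "finite_mgraph G"
  shows "partition_function \<beta> G J M =
           substitute (X_field \<beta>) (\<lambda>e. exp (\<beta> * J e) - 1) (V_polynomial G M)"
  using is_V_polynomial_V_polynomial[OF assms] assms by (rule partition_function_eq_substitute)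

end
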